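(* Let $\Psi=(S,C,F)$ be an expansion system, let $n\in\mathbb N$ and let $y\in S_0$ have coefficients $c_i=\hat P_i(y)$. Then $\Psi$ is proper at order $n$ with respect to $y$ (i.e. $y\in S_0^{(n)}$) if and only if there is an element $y'\in S_0^{[n]}$, i.e. an element $y'\in S_0$ of order $n$, having the same coefficients as $y$ up to and including order $n-1$, i.e. $\hat P_i(y')=\hat P_i(y)=c_i$ for all $i\le n-1$. If this is the case, then $y'$ is unique and equals the $n$-th convergent $y^{[n]}$.
   Context: $\mathbb N=\{0,1,2,\dots\}$. An expansion system $\Psi=(S,C,F)$ consists of sets $S_i$ ($i\in\mathbb N$), each with a distinguished neutral element $\nu_i\in S_i$, sets $C_i$ ($i\in\mathbb N$), and maps $P_i\colon S_i\to C_i$ and $E_i\colon S_i\to S_{i+1}$ such that $E_i(\nu_i)=\nu_{i+1}$ and $F_i=(P_i,E_i)\colon S_i\to C_i\times S_{i+1}$ is injective, for all $i$. For $y\in S_0$ put $y_0=y$, $y_{i+1}=E_i(y_i)$, and $\hat P_i(y)=c_i=P_i(y_i)$ (the coefficients of $y$). Properness and convergents: given $y\in S_0$ with coefficients $c_i$ and $n\in\mathbb N$, set $y^{[n]}_n=\nu_n$ and, for $i=n-1,n-2,\dots,0$, $y^{[n]}_i=F_i^{-1}(c_i,y^{[n]}_{i+1})$, provided $(c_i,y^{[n]}_{i+1})\in F_i(S_i)$. If this proviso holds at every step, $\Psi$ is called proper at order $n$ with respect to $y$, and $y^{[n]}:=y^{[n]}_0$ is the $n$-th convergent of $y$. $S_0^{(n)}$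 denotes the set of all $y\in S_0$ with respect to which $\Psi$ is proper at order $n$. Order: an element $y\in S_0$ is of finite order if $y_n=\nu_n$ for some $n\in\mathbb N$; the smallest such $n$ is called the order of $y$. $S_0^{[n]}$ denotes the set of elements of $S_0$ of order $n$.
   Formalization: "y' of order n" is replaced by "y' of order at most n" throughout (existence, uniqueness, equality with the convergent), since the literal claim fails: for y equal to the neutral element of S_0 and n = 1, Ψ is proper but the only candidate y' has order 0. *)

theory Defs
  imports "HOL-Library.FuncSet"
begin

text \<open>The sets of elements and of coefficients are families of subsets of two ambient types.
  The maps are only constrained on these subsets.\<close>

record ('s, 'c) expansion_data =
  elems :: "nat \<Rightarrow> 's set"
  coefs :: "nat \<Rightarrow> 'c set"
  neutral :: "nat \<Rightarrow> 's"
  P :: "nat \<Rightarrow> 's \<Rightarrow> 'c"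
  E :: "nat \<Rightarrow> 's \<Rightarrow> 's"

definition F :: "('s, 'c) expansion_data \<Rightarrow> nat \<Rightarrow> 's \<Rightarrow> 'c \<times> 's" where
  "F \<Psi> i x = (P \<Psi> i x, E \<Psi> i x)"

definition expansion_system :: "('s, 'c) expansion_data \<Rightarrow> bool" where
  "expansion_system \<Psi> \<longleftrightarrow>
     (\<forall>i. neutral \<Psi> i \<in> elems \<Psi> i \<and>
          P \<Psi> i \<in> elems \<Psi> i \<rightarrow> coefs \<Psi> i \<and>
          E \<Psi> i \<in> elems \<Psi> i \<rightarrow> elems \<Psi> (Suc i) \<and>
          E \<Psi> i (neutral \<Psi> i) = neutral \<Psi> (Suc i) \<and>
          inj_on (F \<Psi> i) (elems \<Psi> i))"

primrec iter :: "('s, 'c) expansion_data \<Rightarrow> 's \<Rightarrow> nat \<Rightarrow> 's" where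
  "iter \<Psi> y 0 = y"
| "iter \<Psi> y (Suc i) = E \<Psi> i (iter \<Psi> y i)"

definition coefficient :: "('s, 'c) expansion_data \<Rightarrow> nat \<Rightarrow> 's \<Rightarrow> 'c" where
  "coefficient \<Psi> i y = P \<Psi> i (iter \<Psi> y i)"

definition F_inv :: "('s, 'c) expansion_data \<Rightarrow> nat \<Rightarrow> 'c \<times> 's \<Rightarrow> 's option" where
  "F_inv \<Psi> i p = (if p \<in> F \<Psi> i ` elems \<Psi> i
                    then Some (inv_into (elems \<Psi> i) (F \<Psi> i) p) else None)"

text \<open>For \<open>i \<le> n\<close>, \<open>back_iter \<Psi> y n i\<close> is the element \<open>y\<^sup>[\<^sup>n\<^sup>]\<^sub>i\<close> of the backward
  recursion from \<open>n\<close> down to \<open>0\<close>; it is \<open>None\<close> once the proviso has failed at some step.\<close>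

function back_iter :: "('s, 'c) expansion_data \<Rightarrow> 's \<Rightarrow> nat \<Rightarrow> nat \<Rightarrow> 's option" where
  "back_iter \<Psi> y n i =
     (if i < n
      then Option.bind (back_iter \<Psi> y n (Suc i)) (\<lambda>z. F_inv \<Psi> i (coefficient \<Psi> i y, z))
      else Some (neutral \<Psi> n))"
  by auto
termination
  by (relation "measure (\<lambda>(\<Psi>, y, n, i). n - i)") auto

declare back_iter.simps [simp del]

definition proper_at :: "('s, 'c) expansion_data \<Rightarrow> nat \<Rightarrow> 's \<Rightarrow> bool" where
  "proper_at \<Psi> n y \<longleftrightarrow> back_iter \<Psi> y n 0 \<noteq> None"

definition proper_set :: "('s, 'c) expansion_data \<Rightarrow> nat \<Rightarrow> 's set" where
  "proper_set \<Psi> n = {y \<in> elems \<Psi> 0. proper_at \<Psi> n y}"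

text \<open>Meaningful only if \<open>proper_at \<Psi> n y\<close>.\<close>

definition nth_convergent :: "('s, 'c) expansion_data \<Rightarrow> nat \<Rightarrow> 's \<Rightarrow> 's" where
  "nth_convergent \<Psi> n y = the (back_iter \<Psi> y n 0)"

definition finite_order :: "('s, 'c) expansion_data \<Rightarrow> 's \<Rightarrow> bool" where
  "finite_order \<Psi> y \<longleftrightarrow> (\<exists>n. iter \<Psi> y n = neutral \<Psi> n)"

text \<open>Meaningful only if \<open>finite_order \<Psi> y\<close>.\<close>

definition expansion_order :: "('s, 'c) expansion_data \<Rightarrow> 's \<Rightarrow> nat" where
  "expansion_order \<Psi> y = (LEAST n. iter \<Psi> y n = neutral \<Psi> n)"

text \<open>Convergents need not have order exactly \<open>n\<close>: every system is proper at each order \<open>n\<close> with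
  respect to the neutral element, whose \<open>n\<close>-th convergent is itself, of order \<open>0\<close>. Hence properness
  at order \<open>n\<close> is characterised through \<open>\<Union>m\<le>n. order_set \<Psi> m\<close>, not \<open>order_set \<Psi> n\<close>.\<close>

definition order_set :: "('s, 'c) expansion_data \<Rightarrow> nat \<Rightarrow> 's set" where
  "order_set \<Psi> n = {y \<in> elems \<Psi> 0. finite_order \<Psi> y \<and> expansion_order \<Psi> y = n}"

end

theory Submission
  imports Defs
begin

text \<open>Since each \<open>F \<Psi> i\<close> is injective, a backward step with data (c, w)
  yields x exactly when x lies in \<open>elems \<Psi> i\<close>, has P-value c and E-image w. So the
  backward recursion started at the neutral element of index n ends in z exactly when the forward
  orbit of z has the coefficients of y below n and is neutral at n
  (\<open>back_iter_eq_Some_iff\<close>). As E preserves neutral elements, the latter says that z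
  has order at most n (\<open>UN_order_set_eq\<close>). Hence the admissible y' are precisely the
  values of the one option \<open>back_iter \<Psi> y n 0\<close>: existence is properness, and
  uniqueness is automatic.\<close>

lemma F_inv_eq_Some_iff:
  assumes "expansion_system \<Psi>"
  shows "F_inv \<Psi> i p = Some x \<longleftrightarrow> x \<in> elems \<Psi> i \<and> F \<Psi> i x = p"
proof -
  have "inj_on (F \<Psi> i) (elems \<Psi> i)"
    using assms by (simp add: expansion_system_def)
  then show ?thesis
    by (cases "p \<in> F \<Psi> i ` elems \<Psi> i") (auto simp: F_inv_def inj_on_eq_iff)
qed

lemma iter_in_elems:
  assumes "expansion_system \<Psi>" "z \<in> elems \<Psi> 0"
  shows "iter \<Psi> z i \<in> elems \<Psi> i"
  using assms by (induction i) (auto simp: expansion_system_def)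

lemma iter_eq_neutral_mono:
  assumes "expansion_system \<Psi>" "iter \<Psi> z m = neutral \<Psi> m" "m \<le> n"
  shows "iter \<Psi> z n = neutral \<Psi> n"
  using assms(3,2) assms(1) by (induction rule: dec_induct) (auto simp: expansion_system_def)

text \<open>An orbit that has become neutral stays neutral. This trades a condition on the least
  neutral index for an equation at the fixed index n, where the backward recursion starts.\<close>

lemma UN_order_set_eq:
  assumes "expansion_system \<Psi>"
  shows "(\<Union>m\<le>n. order_set \<Psi> m) = {z \<in> elems \<Psi> 0. iter \<Psi> z n = neutral \<Psi> n}"
proof (intro set_eqI iffI)
  fix z
  assume "z \<in> (\<Union>m\<le>n. order_set \<Psi> m)"
  then have z: "z \<in> elems \<Psi> 0" "finite_order \<Psi> z" and le: "expansion_order \<Psi> z \<le> n"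
    by (auto simp: order_set_def)
  have "iter \<Psi> z (expansion_order \<Psi> z) = neutral \<Psi> (expansion_order \<Psi> z)"
    using z(2) unfolding finite_order_def expansion_order_def by (rule LeastI_ex)
  with z(1) le show "z \<in> {z \<in> elems \<Psi> 0. iter \<Psi> z n = neutral \<Psi> n}"
    using iter_eq_neutral_mono[OF assms] by blast
next
  fix z
  assume "z \<in> {z \<in> elems \<Psi> 0. iter \<Psi> z n = neutral \<Psi> n}"
  then show "z \<in> (\<Union>m\<le>n. order_set \<Psi> m)"
    by (auto simp: order_set_def finite_order_def expansion_order_def intro: Least_le)
qed

text \<open>This relates consecutive indices without mentioning the partial inverse, so it can be
  used both upward and downward.\<close>

lemma back_iter_step:
  assumes "expansion_system \<Psi>" "i < n"
  shows "back_iter \<Psi> y n i = Some x \<longleftrightarrow>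
    x \<in> elems \<Psi> i \<and> P \<Psi> i x = coefficient \<Psi> i y \<and>
    back_iter \<Psi> y n (Suc i) = Some (E \<Psi> i x)"
  using assms(2)
  by (subst back_iter.simps)
    (auto simp: bind_eq_Some_conv F_inv_eq_Some_iff[OF assms(1)] F_def)

lemma back_iter_self: "back_iter \<Psi> y n n = Some (neutral \<Psi> n)"
  by (subst back_iter.simps) simp

text \<open>Given the result z, going up from 0 identifies the intermediate values with the orbit of
  z; comparison at n gives neutrality. Conversely, going down from n, each orbit element of z is the
  required preimage.\<close>

lemma back_iter_eq_Some_iff:
  assumes "expansion_system \<Psi>"
  shows "back_iter \<Psi> y n 0 = Some z \<longleftrightarrow>
    z \<in> elems \<Psi> 0 \<and> iter \<Psi> z n = neutral \<Psi> n \<and>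
    (\<forall>i<n. coefficient \<Psi> i z = coefficient \<Psi> i y)"
proof
  assume conv: "back_iter \<Psi> y n 0 = Some z"
  have iters: "back_iter \<Psi> y n i = Some (iter \<Psi> z i)" if "i \<le> n" for i
    using that
  proof (induction i)
    case (Suc i)
    then show ?case
      using back_iter_step[OF assms, of i n] by simp
  qed (simp add: conv)
  have "iter \<Psi> z n = neutral \<Psi> n"
    using iters[of n] by (simp add: back_iter_self)
  moreover have "coefficient \<Psi> i z = coefficient \<Psi> i y" if "i < n" for i
    using that iters[of i] back_iter_step[OF assms that] by (simp add: coefficient_def)
  moreover have "z \<in> elems \<Psi> 0"
  \<comment> \<open>For n = 0 no inverse is taken and z is the neutral element itself; otherwise z
    is a preimage under \<open>F \<Psi> 0\<close>.\<close>
  proof (cases n)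
    case 0
    with conv show ?thesis
      using assms by (auto simp: back_iter_self expansion_system_def)
  next
    case (Suc m)
    with conv show ?thesis
      using back_iter_step[OF assms, of 0 n] by simp
  qed
  ultimately show "z \<in> elems \<Psi> 0 \<and> iter \<Psi> z n = neutral \<Psi> n \<and>
    (\<forall>i<n. coefficient \<Psi> i z = coefficient \<Psi> i y)"
    by blast
next
  assume z: "z \<in> elems \<Psi> 0 \<and> iter \<Psi> z n = neutral \<Psi> n \<and>
    (\<forall>i<n. coefficient \<Psi> i z = coefficient \<Psi> i y)"
  have "back_iter \<Psi> y n i = Some (iter \<Psi> z i)" if "i \<le> n" for i
    using that
  proof (induction rule: inc_induct)
    case base
    then show ?case
      using z by (simp add: back_iter_self)
  next
    case (step i)
    then show ?case
      using z iter_in_elems[OF assms] by (simp add: back_iter_step[OF assms] coefficient_def)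
  qed
  from this[of 0] show "back_iter \<Psi> y n 0 = Some z"
    by simp
qed

theorem theorem2p3:
  fixes \<Psi> :: "('s, 'c) expansion_data" and n :: nat and y :: 's
  assumes "expansion_system \<Psi>"
    and "y \<in> elems \<Psi> 0"
  shows "(y \<in> proper_set \<Psi> n \<longleftrightarrow>
           (\<exists>y' \<in> (\<Union>m\<le>n. order_set \<Psi> m). \<forall>i<n. coefficient \<Psi> i y' = coefficient \<Psi> i y)) \<and>
         (y \<in> proper_set \<Psi> n \<longrightarrow>
           (\<exists>!y'. y' \<in> (\<Union>m\<le>n. order_set \<Psi> m) \<and>
                  (\<forall>i<n. coefficient \<Psi> i y' = coefficient \<Psi> i y)) \<and>
           (\<forall>y'. y' \<in> (\<Union>m\<le>n. order_set \<Psi> m) \<and>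
                  (\<forall>i<n. coefficient \<Psi> i y' = coefficient \<Psi> i y) \<longrightarrow>
                  y' = nth_convergent \<Psi> n y))"
proof -
  \<comment> \<open>An option holds at most one value, so this equivalence also gives uniqueness and
    the equality with the convergent.\<close>
  have iff: "y' \<in> (\<Union>m\<le>n. order_set \<Psi> m) \<and>
      (\<forall>i<n. coefficient \<Psi> i y' = coefficient \<Psi> i y) \<longleftrightarrow> back_iter \<Psi> y n 0 = Some y'" for y'
    unfolding UN_order_set_eq[OF assms(1)] back_iter_eq_Some_iff[OF assms(1)] by simp
  have "y \<in> proper_set \<Psi> n \<longleftrightarrow> (\<exists>y'. back_iter \<Psi> y n 0 = Some y')"
    using assms(2) by (simp add: proper_set_def proper_at_def)
  then show ?thesis
    unfolding Bex_def iff by (auto simp: nth_convergent_def)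
qed

end
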